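(* Let $\mathcal{L}_\phi(\phi,T_z,\psi)$ (with $T_z\in\mathbb{R}^{d_\phi\times d_\psi}$) and $\mathcal{L}_\psi(\psi,T_z,\phi)$ (with $T_z\in\mathbb{R}^{d_\psi\times d_\phi}$) be two losses whose gradients match those of $\mathcal{L}_{\mathrm{dens}}$ in the following sense: for all $\phi$, $\psi$, $\{T_z\}_z$ (of the appropriate dimensions) and all $z\in\mathcal{Z}$, 1. $\nabla_{T_z}\mathcal{L}_{\mathrm{dens}}(\phi,T_z,\psi)=\nabla_{T_z}\mathcal{L}_\phi(\phi,T_z,\psi)$; 2. $\nabla_{T_z}\mathcal{L}_{\mathrm{dens}}(\phi,T_z^\top,\psi)=\nabla_{T_z}\mathcal{L}_\psi(\psi,T_z,\phi)$; 3. $\nabla_\phi\mathcal{L}_{\mathrm{dens}}(\phi,T_z,\psi)=\nabla_\phi\mathcal{L}_\phi(\phi,T_z,\psi)$; 4. $\nabla_\psi\mathcal{L}_{\mathrm{dens}}(\phi,T_z^\top,\psi)=\nabla_\psi\mathcal{L}_\psi(\psi,T_z,\phi)$. Then $\mathcal{L}_{\mathrm{dens}}$ is a Lyapunov function for the ODE system $$\begin{cases}T_{\phi,z,t}\in\arg\min_{T_z}\mathcal{L}_\phi(\phi_t,T_z,\psi_t),\\ T_{\psi,z,t}\in\arg\min_{T_z}\mathcal{L}_\psi(\psi_t,T_z,\phi_t),\\ \dot\phi_t=-\nabla_{\phi_t}\mathcal{L}_\phi(\phi_t,T_{\phi,z,t},\psi_t),\\ \dot\psi_t=-\nabla_{\psi_t}\mathcal{L}_\psi(\psi_t,T_{\psi,z,t},\phi_t).\end{cases}$$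 That is, for every solution $(\phi_t,\psi_t)_{t\ge0}$ of the system, the function $\mathcal{L}(t):=\mathcal{L}_{\mathrm{dens}}(\phi_t,T_{z,t},\psi_t)$, where $T_{z,t}\in\arg\min_{T_z}\mathcal{L}_{\mathrm{dens}}(\phi_t,T_z,\psi_t)$, satisfies $\frac{\mathrm{d}}{\mathrm{d}t}\mathcal{L}(t)\le0$ for all $t$, with strict inequality whenever $(\phi_t,\psi_t)$ is not a stationary point of the ODE (i.e. whenever $(\dot\phi_t,\dot\psi_t)\neq(0,0)$).
   Context: Setting: a finite state set with $S$ states; a probability distribution $\rho$ on states with $\rho(s)>0$ for all $s$, and $D_\rho\in\mathbb{R}^{S\times S}$ the diagonal matrix with entries $\rho(s)$; a finite set $\mathcal{Z}$ with a probability distribution $p$ (expectations $\mathbb{E}_z$ are over $z\sim p$); for each $z\in\mathcal{Z}$ an arbitrary kernel $\Xi_z\in\mathbb{R}^{S\times S}$, with $\Xi_z(s^+\mid s)$ in row $s$, column $s^+$. Representations are matrices $\phi\in\mathbb{R}^{S\times d_\phi}$, $\psi\in\mathbb{R}^{S\times d_\psi}$, with $\phi(s)$, $\psi(s)$ the rows viewed as column vectors; predictors are collections of matrices $\{T_z\}_{z\in\mathcal{Z}}$, written simply $T_z$ as an argument of a loss. The density-based loss is, for $T_z\in\mathbb{R}^{d_\phi\times d_\psi}$, $$\mathcal{L}_{\mathrm{dens}}(\phi,T_z,\psi)=\tfrac12\,\mathbb{E}_{z\sim p,\,s\sim\rho,\,s^+\sim\rho}\Big[\Big(\phi(s)^\top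 T_z\psi(s^+)-\frac{\Xi_z(s^+\mid s)}{\rho(s^+)}\Big)^2\Big]=\tfrac12\,\mathbb{E}_z\big\|D_\rho^{1/2}(\phi T_z\psi^\top-\Xi_zD_\rho^{-1})D_\rho^{1/2}\big\|_F^2 .$$ The losses $\mathcal{L}_\phi$ and $\mathcal{L}_\psi$ are differentiable and may contain stop-gradient terms, i.e. terms that have their usual value but are held constant when differentiating and minimizing; $\nabla$ and $\arg\min$ for these losses are understood in this sense (so at an argmin over $T_z$ the gradient $\nabla_{T_z}$ vanishes). Gradients are Euclidean matrix gradients; in conditions 2 and 4, $\nabla$ on the left-hand side is the gradient of the function obtained by inserting $T_z^\top$, $T_z\in\mathbb{R}^{d_\psi\times d_\phi}$, as the predictor of $\mathcal{L}_{\mathrm{dens}}$. A solution of the system consists of differentiable $\phi_t,\psi_t$, $t\ge0$, with predictors $T_{\phi,z,t},T_{\psi,z,t}$ satisfying all four relations for every $t$. *)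

theory Defs
  imports "HOL-Probability.Probability"
begin

definition gradient :: "('a::real_inner \<Rightarrow> real) \<Rightarrow> 'a \<Rightarrow> 'a" where
  "gradient f x = (THE D. GDERIV f x :> D)"

text \<open>
  An argument triple consists of a representation in \<open>\<real>\<^bsup>S\<times>p\<^esup>\<close>, a \<open>z\<close>-indexed family of
  predictors in \<open>\<real>\<^bsup>p\<times>q\<^esup>\<close>, and a second representation in \<open>\<real>\<^bsup>S\<times>q\<^esup>\<close>. In HOL-Analysis
  \<open>real ^ 'q ^ 'p\<close> is the type of matrices with rows indexed by \<open>'p\<close> and columns by \<open>'q\<close>,
  and its inner product is the Frobenius one.
\<close>

type_synonym ('s, 'z, 'p, 'q) loss_args =
  "(real ^ 'p ^ 's) \<times> (real ^ 'q ^ 'p ^ 'z) \<times> (real ^ 'q ^ 's)"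

text \<open>
  A loss with stop-gradient terms is a function \<open>L x y\<close> of two copies of the arguments: \<open>y\<close>
  is what the terms under a stop-gradient see, \<open>x\<close> is what all other occurrences see. Its
  value at \<open>x\<close> is \<open>L x x\<close>; differentiation and minimization act on the first copy only,
  the second being held at the current point. A loss without stop-gradients ignores \<open>y\<close>.
\<close>

type_synonym ('s, 'z, 'p, 'q) sg_loss =
  "('s, 'z, 'p, 'q) loss_args \<Rightarrow> ('s, 'z, 'p, 'q) loss_args \<Rightarrow> real"

definition upd_pred :: "real ^ 'q ^ 'p ^ 'z \<Rightarrow> 'z \<Rightarrow> real ^ 'q ^ 'p \<Rightarrow> real ^ 'q ^ 'p ^ 'z" where
  "upd_pred T z A = (\<chi> z'. if z' = z then A else T $ z')"

definition transpose_pred :: "real ^ 'q ^ 'p ^ 'z \<Rightarrow> real ^ 'p ^ 'q ^ 'z" where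
  "transpose_pred T = (\<chi> z. transpose (T $ z))"

definition sg_differentiable ::
    "('s::finite, 'z::finite, 'p::finite, 'q::finite) sg_loss \<Rightarrow> bool" where
  "sg_differentiable L \<longleftrightarrow> (\<forall>x. (\<lambda>x'. L x' x) differentiable (at x))"

definition sg_grad_rep ::
    "('s::finite, 'z::finite, 'p::finite, 'q::finite) sg_loss \<Rightarrow>
      real ^ 'p ^ 's \<Rightarrow> real ^ 'q ^ 'p ^ 'z \<Rightarrow> real ^ 'q ^ 's \<Rightarrow> real ^ 'p ^ 's" where
  "sg_grad_rep L \<phi> T \<psi> = gradient (\<lambda>\<phi>'. L (\<phi>', T, \<psi>) (\<phi>, T, \<psi>)) \<phi>"

definition sg_grad_pred ::
    "('s::finite, 'z::finite, 'p::finite, 'q::finite) sg_loss \<Rightarrow>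
      real ^ 'p ^ 's \<Rightarrow> real ^ 'q ^ 'p ^ 'z \<Rightarrow> real ^ 'q ^ 's \<Rightarrow> 'z \<Rightarrow> real ^ 'q ^ 'p" where
  "sg_grad_pred L \<phi> T \<psi> z = gradient (\<lambda>A. L (\<phi>, upd_pred T z A, \<psi>) (\<phi>, T, \<psi>)) (T $ z)"

definition sg_is_arg_min_pred ::
    "('s::finite, 'z::finite, 'p::finite, 'q::finite) sg_loss \<Rightarrow>
      real ^ 'p ^ 's \<Rightarrow> real ^ 'q ^ 's \<Rightarrow> real ^ 'q ^ 'p ^ 'z \<Rightarrow> bool" where
  "sg_is_arg_min_pred L \<phi> \<psi> T \<longleftrightarrow>
     is_arg_min (\<lambda>T'. L (\<phi>, T', \<psi>) (\<phi>, T, \<psi>)) (\<lambda>_. True) T"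

text \<open>
  \<open>\<Xi> z $ s $ s'\<close> is the entry \<open>\<Xi>\<^sub>z(s' | s)\<close>; the kernels are arbitrary real matrices.
\<close>

definition dens_loss ::
    "'s::finite pmf \<Rightarrow> 'z::finite pmf \<Rightarrow> ('z \<Rightarrow> real ^ 's ^ 's) \<Rightarrow>
      ('s, 'z, 'p::finite, 'q::finite) loss_args \<Rightarrow> real" where
  "dens_loss \<rho> p \<Xi> = (\<lambda>(\<phi>, T, \<psi>).
     1/2 * measure_pmf.expectation (pair_pmf p (pair_pmf \<rho> \<rho>))
       (\<lambda>(z, s, s'). (inner (\<phi> $ s) (T $ z *v \<psi> $ s') - \<Xi> z $ s $ s' / pmf \<rho> s')\<^sup>2))"

definition ode_solution ::
    "('s::finite, 'z::finite, 'p::finite, 'q::finite) sg_loss \<Rightarrow> ('s, 'z, 'q, 'p) sg_loss \<Rightarrow>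
      (real \<Rightarrow> real ^ 'p ^ 's) \<Rightarrow> (real \<Rightarrow> real ^ 'q ^ 's) \<Rightarrow>
      (real \<Rightarrow> real ^ 'q ^ 'p ^ 'z) \<Rightarrow> (real \<Rightarrow> real ^ 'p ^ 'q ^ 'z) \<Rightarrow> bool" where
  "ode_solution L\<^sub>\<phi> L\<^sub>\<psi> \<phi> \<psi> T\<^sub>\<phi> T\<^sub>\<psi> \<longleftrightarrow>
     (\<forall>t\<ge>0.
        sg_is_arg_min_pred L\<^sub>\<phi> (\<phi> t) (\<psi> t) (T\<^sub>\<phi> t) \<and>
        sg_is_arg_min_pred L\<^sub>\<psi> (\<psi> t) (\<phi> t) (T\<^sub>\<psi> t) \<and>
        (\<phi> has_vector_derivative - sg_grad_rep L\<^sub>\<phi> (\<phi> t) (T\<^sub>\<phi> t) (\<psi> t)) (at t within {0..}) \<and>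
        (\<psi> has_vector_derivative - sg_grad_rep L\<^sub>\<psi> (\<psi> t) (T\<^sub>\<psi> t) (\<phi> t)) (at t within {0..}))"

end

theory Submission
  imports Defs
begin

text \<open>
  Let \<open>F(\<phi>, T, \<psi>)\<close> be \<open>\<phi> T\<^sub>z \<psi>\<^sup>T\<close> with entries scaled by square roots of the sampling weights, so that
  the density loss is \<open>1/2 \<bar>F(\<phi>, T, \<psi>) - c\<bar>\<^sup>2\<close>. At an optimal predictor \<open>\<phi>\<^sup>T \<nabla>\<^sub>\<phi> L = (\<nabla>\<^sub>T L) T\<^sup>T = 0\<close>,
  hence \<open>\<phi>\<^sup>T \<phi>\<close>, and likewise \<open>\<psi>\<^sup>T \<psi>\<close>, is constant along the flow. In particular the ranks do not
  drop, although the optimal predictors may be neither unique nor continuous in time. With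
  \<open>A\<^sub>s = F(\<phi>\<^sub>s, \<cdot>, \<psi>\<^sub>s)\<close>, Pythagoras gives
  \<open>L(s) = 1/2 \<bar>A\<^sub>s T\<^sub>t - c\<bar>\<^sup>2 - 1/2 \<bar>A\<^sub>s (T\<^sub>t - T\<^sub>s)\<bar>\<^sup>2\<close>, where constancy of the Gram matrices makes the last
  term \<open>O((s - t)\<^sup>2)\<close>, so \<open>L\<close> is differentiated with the predictor held fixed. Two optimal predictors
  differ by some \<open>N\<close> with \<open>A\<^sub>s N = 0\<close> for all \<open>s\<close>, so each of them yields the same derivative, namely
  \<open>- \<bar>\<phi>'\<bar>\<^sup>2 - \<bar>\<psi>'\<bar>\<^sup>2\<close>.
\<close>

section \<open>Gradients and linear least squares\<close>

text \<open>Uniqueness of derivatives makes the definite description in \<open>gradient\<close>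
  meaningful; the representing vector is assembled from the values of \<open>f'\<close> on the
  basis.\<close>

lemma inner_gradient:
  fixes f :: "'a::euclidean_space \<Rightarrow> real"
  assumes f': "(f has_derivative f') (at x)"
  shows "inner v (gradient f x) = f' v"
proof -
  define D where "D = (\<Sum>b\<in>Basis. f' b *\<^sub>R b)"
  interpret bounded_linear f' by (rule has_derivative_bounded_linear [OF f'])
  have inner_D: "f' h = inner h D" for h
  proof -
    have "f' h = f' (\<Sum>b\<in>Basis. inner h b *\<^sub>R b)"
      by (simp add: euclidean_representation)
    also have "\<dots> = inner h D"
      by (simp add: sum scale D_def inner_sum_right mult.commute)
    finally show ?thesis .
  qed
  have "gradient f x = D"
    unfolding gradient_def
  proof (rule the_equality)
    show "GDERIV f x :> D"
      using f' inner_D unfolding gderiv_def by (metis (no_types, lifting) ext)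
    show "E = D" if "GDERIV f x :> E" for E
    proof -
      have "f' = (\<lambda>h. inner h E)"
        using that f' has_derivative_unique unfolding gderiv_def by blast
      then show ?thesis
        using inner_D by (metis vector_eq_rdot inner_commute)
    qed
  qed
  then show ?thesis
    by (simp add: inner_D)
qed

lemma gradient_eq_0_at_min:
  fixes f :: "'a::euclidean_space \<Rightarrow> real"
  assumes "f differentiable (at x)" and "is_arg_min f (\<lambda>_. True) x"
  shows "gradient f x = 0"
proof -
  obtain f' where f': "(f has_derivative f') (at x)"
    using assms(1) by (auto simp: differentiable_def)
  have "f' = (\<lambda>h. 0)"
    using f' by (rule has_derivative_local_min) (use assms(2) in \<open>simp add: is_arg_min_linorder\<close>)
  then show ?thesis
    using inner_gradient [OF f'] by (metis inner_eq_zero_iff)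
qed

lemma has_derivative_least_squares:
  fixes A :: "'a::euclidean_space \<Rightarrow> 'b::euclidean_space"
  assumes "linear A"
  shows "((\<lambda>x. 1/2 * (norm (A x - b))\<^sup>2) has_derivative (\<lambda>v. inner (A v) (A x - b))) (at x)"
proof -
  have A: "(A has_derivative A) (at x)"
    using assms by (rule linear_imp_has_derivative)
  show ?thesis
    unfolding power2_norm_eq_inner
    by (rule derivative_eq_intros A refl)+ (auto simp: inner_commute fun_eq_iff)
qed

lemma inner_gradient_least_squares:
  fixes A :: "'a::euclidean_space \<Rightarrow> 'b::euclidean_space"
  assumes "linear A" and "\<And>y. h y = 1/2 * (norm (A y - b))\<^sup>2"
  shows "inner v (gradient h x) = inner (A v) (A x - b)"
proof -
  have "h = (\<lambda>y. 1/2 * (norm (A y - b))\<^sup>2)"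
    using assms(2) by blast
  then show ?thesis
    using inner_gradient [OF has_derivative_least_squares [OF assms(1), of b x]] by simp
qed

section \<open>Derivative of the minimum in a time-dependent least-squares problem\<close>

text \<open>Both functions vanish at \<open>t\<close>, so the difference quotient of
  \<open>f\<close> is dominated by that of \<open>u\<close>. This handles an error term built from a
  possibly discontinuous choice of minimizers.\<close>

lemma has_real_derivative_0_squeeze:
  fixes f u :: "real \<Rightarrow> real"
  assumes u: "(u has_real_derivative 0) (at t within S)" "u t = 0"
    and f: "\<And>s. s \<in> S \<Longrightarrow> 0 \<le> f s" "\<And>s. s \<in> S \<Longrightarrow> f s \<le> u s"
    and t: "t \<in> S"
  shows "(f has_real_derivative 0) (at t within S)"
proof -
  have ft: "f t = 0"
    using f [OF t] u by simp
  have lim: "((\<lambda>y. \<bar>(u y - u t) / (y - t)\<bar>) \<longlongrightarrow> 0) (at t within S)"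
    using u(1) unfolding has_field_derivative_iff by (rule tendsto_rabs_zero)
  have ev: "eventually (\<lambda>y. norm ((f y - f t) / (y - t)) \<le> \<bar>(u y - u t) / (y - t)\<bar>) (at t within S)"
    unfolding eventually_at_filter
  proof (intro always_eventually allI impI)
    fix y assume "y \<noteq> t" "y \<in> S"
    then show "norm ((f y - f t) / (y - t)) \<le> \<bar>(u y - u t) / (y - t)\<bar>"
      using f [of y] ft u(2) by (simp add: abs_divide divide_right_mono)
  qed
  show ?thesis
    unfolding has_field_derivative_iff by (rule Lim_null_comparison [OF ev lim])
qed

text \<open>An envelope theorem: \<open>normal\<close> says that \<open>T s\<close> is optimal at
  time \<open>s\<close>, and the choice is otherwise arbitrary. By \<open>bound\<close> the kernel
  of \<open>A s\<close> lies in that of \<open>A t\<close>, by \<open>ker\<close> the converse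
  holds; hence the rank does not jump and the error estimate is uniform in \<open>s\<close>.\<close>

lemma min_least_squares_has_real_derivative:
  fixes A :: "real \<Rightarrow> 'a::euclidean_space \<Rightarrow> 'b::euclidean_space"
  assumes lin: "\<And>s. s \<in> S \<Longrightarrow> linear (A s)"
    and t: "t \<in> S"
    and der: "\<And>X. ((\<lambda>s. A s X) has_vector_derivative A' X) (at t within S)"
    and bound: "\<And>s X. s \<in> S \<Longrightarrow> norm (A t X) \<le> C * norm (A s X)"
    and ker: "\<And>s X. s \<in> S \<Longrightarrow> A t X = 0 \<Longrightarrow> A s X = 0"
    and normal: "\<And>s X. s \<in> S \<Longrightarrow> inner (A s X) (A s (T s) - c) = 0"
  shows "((\<lambda>s. 1/2 * (norm (A s (T s) - c))\<^sup>2) has_real_derivative inner (A' (T t)) (A t (T t) - c))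
    (at t within S)"
proof -
  \<comment> \<open>A bounded choice of preimages under \<open>A t\<close>: the difference
    \<open>T t - T s\<close> may be arbitrarily large inside the kernel, so it is not estimated
    directly.\<close>
  obtain g where g: "linear g" "\<And>X. A t (g (A t X)) = A t X"
    using linear_exists_right_inverse_on [OF lin [OF t] subspace_UNIV] by auto
  obtain K where K: "\<And>y. norm (g y) \<le> K * norm y" "K > 0"
    using linear_bounded_pos [OF g(1)] by metis
  \<comment> \<open>the gradient at \<open>T t\<close> of the least-squares problem at time \<open>s\<close>; it vanishes for \<open>s = t\<close>\<close>
  define \<gamma> where "\<gamma> = (\<lambda>s. \<Sum>b\<in>Basis. inner (A s b) (A s (T t) - c) *\<^sub>R b)"
  have inner_\<gamma>: "inner X (\<gamma> s) = inner (A s X) (A s (T t) - c)" if "s \<in> S" for X s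
  proof -
    interpret linear "A s" by (rule lin [OF that])
    have "A s X = A s (\<Sum>b\<in>Basis. inner X b *\<^sub>R b)"
      by (simp add: euclidean_representation)
    also have "\<dots> = (\<Sum>b\<in>Basis. inner X b *\<^sub>R A s b)"
      by (simp add: sum scale)
    finally show ?thesis
      by (simp add: \<gamma>_def inner_sum_right inner_sum_left mult.commute)
  qed
  have \<gamma>t: "\<gamma> t = 0"
    using normal [OF t] by (simp add: \<gamma>_def)
  have \<gamma>': "(\<gamma> has_vector_derivative
      (\<Sum>b\<in>Basis. (inner (A t b) (A' (T t)) + inner (A' b) (A t (T t) - c)) *\<^sub>R b)) (at t within S)"
    unfolding \<gamma>_def has_vector_derivative_def
    by (rule derivative_eq_intros der [unfolded has_vector_derivative_def] refl)+
      (simp add: fun_eq_iff scaleR_sum_right distrib_left)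
  define M where "M = (K * C)\<^sup>2"
  define e where "e = (\<lambda>s. (norm (A s (T t - T s)))\<^sup>2)"
  have e_le: "e s \<le> M * inner (\<gamma> s) (\<gamma> s)" if s: "s \<in> S" for s
  proof -
    interpret linear "A s" by (rule lin [OF s])
    define X where "X = T t - T s"
    \<comment> \<open>\<open>Y\<close> equals \<open>X\<close> modulo the common kernel, but its
      norm is controlled by \<open>A s X\<close>. Pairing with the gradient then bounds
      \<open>A s X\<close> by a multiple of \<open>\<gamma> s\<close>.\<close>
    define Y where "Y = g (A t X)"
    have "A t (X - Y) = 0"
      using g(2) [of X] linear_diff [OF lin [OF t]] by (simp add: Y_def)
    then have "A s X = A s Y"
      using ker [OF s] diff by fastforce
    have "norm Y \<le> K * norm (A t X)"
      unfolding Y_def by (rule K)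
    also have "\<dots> \<le> K * (C * norm (A s X))"
      using bound [OF s] K(2) by (simp add: mult_left_mono)
    finally have Y: "norm Y \<le> K * C * norm (A s X)" by simp
    have "(norm (A s X))\<^sup>2 = inner (A s X) (A s (T t) - c) - inner (A s X) (A s (T s) - c)"
      by (simp add: X_def diff power2_norm_eq_inner inner_diff_right)
    also have "\<dots> = inner (A s Y) (A s (T t) - c)"
      using normal [OF s] \<open>A s X = A s Y\<close> by simp
    also have "\<dots> = inner Y (\<gamma> s)"
      by (simp add: inner_\<gamma> s)
    also have "\<dots> \<le> norm Y * norm (\<gamma> s)"
      by (rule norm_cauchy_schwarz)
    also have "\<dots> \<le> K * C * norm (A s X) * norm (\<gamma> s)"
      using Y by (simp add: mult_right_mono)
    finally have "norm (A s X) * norm (A s X) \<le> (K * C * norm (\<gamma> s)) * norm (A s X)"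
      by (simp add: power2_eq_square mult_ac)
    \<comment> \<open>If \<open>A s X = 0\<close>, nothing can be cancelled; the absolute value
      keeps the bound true there, whatever the sign of \<open>C\<close>.\<close>
    then have "norm (A s X) \<le> \<bar>K * C * norm (\<gamma> s)\<bar>"
      by (cases "norm (A s X) = 0") auto
    then have "(norm (A s X))\<^sup>2 \<le> (K * C * norm (\<gamma> s))\<^sup>2"
      using power_mono [of _ "\<bar>K * C * norm (\<gamma> s)\<bar>" 2] by simp
    then show ?thesis
      by (simp add: e_def X_def M_def power_mult_distrib power2_norm_eq_inner)
  qed
  \<comment> \<open>Quadratic in \<open>\<gamma>\<close>, which is differentiable and zero at
    \<open>t\<close>.\<close>
  have "((\<lambda>s. M * inner (\<gamma> s) (\<gamma> s)) has_real_derivative 0) (at t within S)"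
    unfolding has_field_derivative_def
    by (rule derivative_eq_intros \<gamma>' [unfolded has_vector_derivative_def] refl)+
      (simp add: \<gamma>t fun_eq_iff)
  then have e': "(e has_real_derivative 0) (at t within S)"
    by (rule has_real_derivative_0_squeeze) (use e_le t in \<open>auto simp: e_def \<gamma>t\<close>)
  have main: "((\<lambda>s. 1/2 * (norm (A s (T t) - c))\<^sup>2 - 1/2 * e s) has_real_derivative
      inner (A' (T t)) (A t (T t) - c)) (at t within S)"
    unfolding has_field_derivative_def power2_norm_eq_inner
    by (rule derivative_eq_intros der [unfolded has_vector_derivative_def]
        e' [unfolded has_field_derivative_def] refl)+
      (auto simp: fun_eq_iff inner_commute)
  have "1/2 * (norm (A s (T s) - c))\<^sup>2 = 1/2 * (norm (A s (T t) - c))\<^sup>2 - 1/2 * e s"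
    if s: "s \<in> S" for s
  proof -
    interpret linear "A s" by (rule lin [OF s])
    have "A s (T t) - c = A s (T t - T s) + (A s (T s) - c)"
      by (simp add: diff)
    moreover have "orthogonal (A s (T t - T s)) (A s (T s) - c)"
      using normal [OF s] by (simp add: orthogonal_def)
    ultimately have "(norm (A s (T t) - c))\<^sup>2 = e s + (norm (A s (T s) - c))\<^sup>2"
      unfolding e_def by (metis norm_add_Pythagorean)
    then show ?thesis by (simp add: field_simps)
  qed
  then show ?thesis
    by (intro has_field_derivative_transform_within [OF main zero_less_one t]) simp
qed

section \<open>The density loss as a least-squares problem\<close>

definition dens_map ::
    "'s::finite pmf \<Rightarrow> 'z::finite pmf \<Rightarrow> real ^ 'p ^ 's \<Rightarrow> real ^ 'q ^ 'p ^ 'z \<Rightarrow> real ^ 'q ^ 's \<Rightarrow>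
      real ^ 's ^ 's ^ 'z" where
  "dens_map \<rho> p \<phi> T \<psi> = (\<chi> z s s'. sqrt (pmf p z * (pmf \<rho> s * pmf \<rho> s')) *
     inner (\<phi> $ s) (T $ z *v \<psi> $ s'))"

definition dens_target ::
    "'s::finite pmf \<Rightarrow> 'z::finite pmf \<Rightarrow> ('z \<Rightarrow> real ^ 's ^ 's) \<Rightarrow> real ^ 's ^ 's ^ 'z" where
  "dens_target \<rho> p \<Xi> = (\<chi> z s s'. sqrt (pmf p z * (pmf \<rho> s * pmf \<rho> s')) *
     (\<Xi> z $ s $ s' / pmf \<rho> s'))"

lemma power2_norm_vec: "(norm x)\<^sup>2 = (\<Sum>i\<in>UNIV. (norm (x $ i))\<^sup>2)"
  by (simp add: norm_vec_def L2_set_def sum_nonneg)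

lemma dens_loss_eq:
  "dens_loss \<rho> p \<Xi> (\<phi>, T, \<psi>) = 1/2 * (norm (dens_map \<rho> p \<phi> T \<psi> - dens_target \<rho> p \<Xi>))\<^sup>2"
proof -
  have "dens_loss \<rho> p \<Xi> (\<phi>, T, \<psi>) = 1/2 * (\<Sum>(z, s, s')\<in>UNIV. pmf p z * (pmf \<rho> s * pmf \<rho> s') *
      (inner (\<phi> $ s) (T $ z *v \<psi> $ s') - \<Xi> z $ s $ s' / pmf \<rho> s')\<^sup>2)"
    unfolding dens_loss_def
    by (subst integral_measure_pmf_real [of UNIV])
      (auto simp: pmf_pair split_beta mult_ac intro!: sum.cong)
  also have "(\<Sum>(z, s, s')\<in>UNIV. pmf p z * (pmf \<rho> s * pmf \<rho> s') *
      (inner (\<phi> $ s) (T $ z *v \<psi> $ s') - \<Xi> z $ s $ s' / pmf \<rho> s')\<^sup>2) =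
      (norm (dens_map \<rho> p \<phi> T \<psi> - dens_target \<rho> p \<Xi>))\<^sup>2"
    \<comment> \<open>The common square root has to be factored out of the difference; merging it
      into the quotient by \<open>pmf \<rho> s'\<close> would hide it.\<close>
    by (simp add: power2_norm_vec dens_map_def dens_target_def power_mult_distrib sum.cartesian_product
        del: times_divide_eq_right flip: UNIV_Times_UNIV right_diff_distrib)
  finally show ?thesis .
qed

lemma dens_map_linear_left: "linear (\<lambda>\<phi>. dens_map \<rho> p \<phi> T \<psi>)"
  by (rule linearI) (simp_all add: dens_map_def vec_eq_iff inner_add_left algebra_simps)

lemma dens_map_linear_mid: "linear (\<lambda>T. dens_map \<rho> p \<phi> T \<psi>)"
  by (rule linearI)
    (simp_all add: dens_map_def vec_eq_iff inner_add_right matrix_vector_mult_add_rdistrib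
      scaleR_matrix_vector_assoc [symmetric] algebra_simps)

lemma dens_map_linear_right: "linear (\<lambda>\<psi>. dens_map \<rho> p \<phi> T \<psi>)"
  by (rule linearI)
    (simp_all add: dens_map_def vec_eq_iff inner_add_right matrix_vector_right_distrib
      matrix_vector_mult_scaleR algebra_simps)

lemma bounded_bilinear_dens_map: "bounded_bilinear (\<lambda>\<phi> \<psi>. dens_map \<rho> p \<phi> T \<psi>)"
  using dens_map_linear_left dens_map_linear_right
  by (metis bilinear_conv_bounded_bilinear bilinear_def)

section \<open>Rank-one matrices as perturbation directions\<close>

definition outer :: "real ^ 'i \<Rightarrow> real ^ 'j \<Rightarrow> real ^ 'j ^ 'i" where
  "outer a b = (\<chi> i j. a $ i * b $ j)"

lemma outer_nth: "outer a b $ i = a $ i *\<^sub>R b"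
  by (simp add: outer_def vec_eq_iff)

lemma outer_mult_vec: "outer a b *v u = inner b u *\<^sub>R a"
  by (simp add: vec_eq_iff matrix_vector_mul_component outer_nth mult.commute)

lemma inner_outer: "inner (outer a b) M = inner a (M *v b)"
proof -
  have "inner (outer a b) M = (\<Sum>i\<in>UNIV. a $ i * inner b (M $ i))"
    by (subst inner_vec_def) (simp add: outer_nth)
  also have "\<dots> = inner a (M *v b)"
    by (subst inner_vec_def) (simp add: matrix_vector_mul_component inner_commute)
  finally show ?thesis .
qed

lemma inner_transpose_mult: "inner (transpose A *v x) u = inner x (A *v u)"
  for A :: "real ^ 'n ^ 'm"
  by (metis dot_lmul_matrix transpose_matrix_vector transpose_transpose)

text \<open>Associativity, \<open>(\<phi> x x^T) T = \<phi> (x x^T T)\<close>: moving the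
  representation in this direction has the effect of moving the predictor. This links the normal
  equations to the conservation of the Gram matrix.\<close>

lemma dens_map_outer_left:
  "dens_map \<rho> p (outer (\<phi> *v x) x) T \<psi> =
   dens_map \<rho> p \<phi> (\<chi> z. outer x (transpose (T $ z) *v x)) \<psi>"
  by (simp add: dens_map_def vec_eq_iff outer_nth outer_mult_vec inner_transpose_mult
      matrix_vector_mul_component dot_lmul_matrix mult_ac)

lemma dens_map_outer_right:
  "dens_map \<rho> p \<phi> T (outer (\<psi> *v x) x) = dens_map \<rho> p \<phi> (\<chi> z. outer (T $ z *v x) x) \<psi>"
  by (simp add: dens_map_def vec_eq_iff outer_nth outer_mult_vec matrix_vector_mult_scaleR
      matrix_vector_mul_component inner_commute mult_ac)

section \<open>Comparison of norms under equal Gram matrices\<close>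

lemma power2_norm_dens_map:
  "(norm (dens_map \<rho> p \<phi> T \<psi>))\<^sup>2 = (\<Sum>z\<in>UNIV. \<Sum>s\<in>UNIV. \<Sum>s'\<in>UNIV.
     pmf p z * (pmf \<rho> s * pmf \<rho> s') * (inner (\<phi> $ s) (T $ z *v \<psi> $ s'))\<^sup>2)"
  by (simp add: power2_norm_vec dens_map_def power_mult_distrib)

text \<open>Grouping by \<open>z\<close> and \<open>s'\<close> lets \<open>\<phi>\<close> enter only
  through weighted norms of vectors \<open>\<phi> *v v\<close>.\<close>

lemma power2_norm_dens_map':
  "(norm (dens_map \<rho> p \<phi> T \<psi>))\<^sup>2 = (\<Sum>z\<in>UNIV. \<Sum>s'\<in>UNIV. pmf p z * pmf \<rho> s' *
     (\<Sum>s\<in>UNIV. pmf \<rho> s * ((\<phi> *v (T $ z *v \<psi> $ s')) $ s)\<^sup>2))"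
  unfolding power2_norm_dens_map
  by (rule sum.cong [OF refl], subst sum.swap)
    (simp add: matrix_vector_mul_component sum_distrib_left mult_ac)

text \<open>The weights are symmetric in the two states, so transposition carries estimates for the
  left representation over to the right one.\<close>

lemma norm_dens_map_transpose:
  "norm (dens_map \<rho> p \<phi> T \<psi>) = norm (dens_map \<rho> p \<psi> (transpose_pred T) \<phi>)"
proof -
  have eq: "inner (\<psi> $ s) (transpose_pred T $ z *v \<phi> $ s') = inner (\<phi> $ s') (T $ z *v \<psi> $ s)" for s s' z
    unfolding transpose_pred_def vec_lambda_beta by (metis inner_commute inner_transpose_mult)
  have "(norm (dens_map \<rho> p \<phi> T \<psi>))\<^sup>2 = (norm (dens_map \<rho> p \<psi> (transpose_pred T) \<phi>))\<^sup>2"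
    unfolding power2_norm_dens_map
    by (rule sum.cong [OF refl], subst sum.swap) (simp add: eq mult_ac)
  then show ?thesis
    by (simp add: power2_eq_iff_nonneg)
qed

text \<open>The weights lie between \<open>m\<close> and 1, so weighted norms of
  \<open>\<phi> *v v\<close> are comparable to the unweighted norm, which depends only on the Gram
  matrix of \<open>\<phi>\<close>.\<close>

lemma norm_dens_map_le_left:
  assumes "\<And>v. norm (\<phi> *v v) = norm (\<phi>' *v v)" and m: "\<And>s. m \<le> pmf \<rho> s" "0 \<le> m"
  shows "m * (norm (dens_map \<rho> p \<phi> T \<psi>))\<^sup>2 \<le> (norm (dens_map \<rho> p \<phi>' T \<psi>))\<^sup>2"
proof -
  have le: "m * (\<Sum>s\<in>UNIV. pmf \<rho> s * ((\<phi> *v v) $ s)\<^sup>2) \<le> (\<Sum>s\<in>UNIV. pmf \<rho> s * ((\<phi>' *v v) $ s)\<^sup>2)" for v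
  proof -
    have "(\<Sum>s\<in>UNIV. pmf \<rho> s * ((\<phi> *v v) $ s)\<^sup>2) \<le> (\<Sum>s\<in>UNIV. ((\<phi> *v v) $ s)\<^sup>2)"
      by (intro sum_mono mult_left_le_one_le) (auto simp: pmf_le_1)
    also have "\<dots> = (\<Sum>s\<in>UNIV. ((\<phi>' *v v) $ s)\<^sup>2)"
      using power2_norm_vec [of "\<phi> *v v"] power2_norm_vec [of "\<phi>' *v v"] assms(1) by simp
    finally have "m * (\<Sum>s\<in>UNIV. pmf \<rho> s * ((\<phi> *v v) $ s)\<^sup>2) \<le> m * (\<Sum>s\<in>UNIV. ((\<phi>' *v v) $ s)\<^sup>2)"
      using m(2) by (rule mult_left_mono)
    also have "\<dots> \<le> (\<Sum>s\<in>UNIV. pmf \<rho> s * ((\<phi>' *v v) $ s)\<^sup>2)"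
      unfolding sum_distrib_left by (intro sum_mono mult_right_mono m) auto
    finally show ?thesis .
  qed
  have "m * (norm (dens_map \<rho> p \<phi> T \<psi>))\<^sup>2 = (\<Sum>z\<in>UNIV. \<Sum>s'\<in>UNIV. pmf p z * pmf \<rho> s' *
     (m * (\<Sum>s\<in>UNIV. pmf \<rho> s * ((\<phi> *v (T $ z *v \<psi> $ s')) $ s)\<^sup>2)))"
    unfolding power2_norm_dens_map' sum_distrib_left [of m _ UNIV] mult.left_commute [of m] ..
  also have "\<dots> \<le> (norm (dens_map \<rho> p \<phi>' T \<psi>))\<^sup>2"
    unfolding power2_norm_dens_map' by (intro sum_mono mult_left_mono le) auto
  finally show ?thesis .
qed

text \<open>The representations are exchanged one at a time. Each exchange costs a factor
  \<open>m\<close>, the least state probability, in the squared norm, whence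
  \<open>C = 1 / m\<close>, uniformly in the representations.\<close>

lemma norm_dens_map_le:
  assumes "\<And>s. pmf \<rho> s > 0"
  obtains C where "\<And>\<phi> \<phi>' T \<psi> \<psi>'.
    (\<And>v. norm (\<phi> *v v) = norm (\<phi>' *v v)) \<Longrightarrow> (\<And>v. norm (\<psi> *v v) = norm (\<psi>' *v v)) \<Longrightarrow>
    norm (dens_map \<rho> p \<phi> T \<psi>) \<le> C * norm (dens_map \<rho> p \<phi>' T \<psi>')"
proof -
  define m where "m = Min (range (pmf \<rho>))"
  have m: "m \<le> pmf \<rho> s" "0 < m" for s
    using assms by (auto simp: m_def)
  have "norm (dens_map \<rho> p \<phi> T \<psi>) \<le> 1 / m * norm (dens_map \<rho> p \<phi>' T \<psi>')"
    if "\<And>v. norm (\<phi> *v v) = norm (\<phi>' *v v)" "\<And>v. norm (\<psi> *v v) = norm (\<psi>' *v v)"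
    for \<phi> \<phi>' T \<psi> \<psi>'
  proof -
    have 1: "m * (norm (dens_map \<rho> p \<phi> T \<psi>))\<^sup>2 \<le> (norm (dens_map \<rho> p \<phi>' T \<psi>))\<^sup>2"
      using that(1) m by (intro norm_dens_map_le_left) (auto intro: less_imp_le)
    have 2: "m * (norm (dens_map \<rho> p \<phi>' T \<psi>))\<^sup>2 \<le> (norm (dens_map \<rho> p \<phi>' T \<psi>'))\<^sup>2"
      unfolding norm_dens_map_transpose [of _ _ \<phi>']
      using that(2) m by (intro norm_dens_map_le_left) (auto intro: less_imp_le)
    have "(m * norm (dens_map \<rho> p \<phi> T \<psi>))\<^sup>2 = m * (m * (norm (dens_map \<rho> p \<phi> T \<psi>))\<^sup>2)"
      by (simp add: power2_eq_square)
    also have "\<dots> \<le> m * (norm (dens_map \<rho> p \<phi>' T \<psi>))\<^sup>2"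
      using 1 m by (simp add: mult_left_mono less_imp_le)
    also note 2
    finally have "m * norm (dens_map \<rho> p \<phi> T \<psi>) \<le> norm (dens_map \<rho> p \<phi>' T \<psi>')"
      by (rule power2_le_imp_le) simp
    then show ?thesis
      using m(2) by (simp add: field_simps)
  qed
  then show ?thesis
    using that by blast
qed

section \<open>Blocks of predictor families and the normal equations\<close>

text \<open>Replacing a block is affine in \<open>A\<close>; this isolates the linear part.\<close>

lemma upd_pred_split: "upd_pred T z A = upd_pred 0 z A + upd_pred T z 0"
  by (simp add: upd_pred_def vec_eq_iff)

lemma linear_upd_pred: "linear (upd_pred 0 z)"
  by (rule linearI) (simp_all add: upd_pred_def vec_eq_iff)

lemma upd_pred_self: "upd_pred T z (T $ z) = T"
  by (simp add: upd_pred_def vec_eq_iff)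

lemma sum_upd_pred: "(\<Sum>z\<in>UNIV. upd_pred 0 z (T $ z)) = T"
  by (simp add: upd_pred_def vec_eq_iff if_distrib [of "\<lambda>A. A $ _ $ _"] cong: if_cong)

lemma linear_transpose_pred: "linear transpose_pred"
  by (rule linearI) (simp_all add: transpose_pred_def vec_eq_iff transpose_def)

lemma transpose_pred_invol: "transpose_pred (transpose_pred T) = T"
  by (simp add: transpose_pred_def vec_eq_iff)

text \<open>A minimizing family also minimizes in each block, and minimization and differentiation
  freeze the same second copy of the arguments, so Fermat's rule applies.\<close>

lemma sg_grad_pred_arg_min:
  fixes L :: "('s::finite, 'z::finite, 'p::finite, 'q::finite) sg_loss"
  assumes "sg_differentiable L" "sg_is_arg_min_pred L \<phi> \<psi> T"
  shows "sg_grad_pred L \<phi> T \<psi> z = 0"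
  unfolding sg_grad_pred_def
proof (rule gradient_eq_0_at_min)
  have *: "(\<lambda>x. L x (\<phi>, T, \<psi>)) differentiable (at (\<phi>, upd_pred T z (T $ z), \<psi>))"
    using assms(1) by (simp add: upd_pred_self sg_differentiable_def)
  have "linear (upd_pred 0 z :: real ^ 'q ^ 'p \<Rightarrow> _)" by (rule linear_upd_pred)
  then have "(\<lambda>A. (\<phi>, upd_pred 0 z A + upd_pred T z 0, \<psi>)) differentiable (at (T $ z))"
    by (intro derivative_intros linear_imp_differentiable)
  then have "(\<lambda>A. (\<phi>, upd_pred T z A, \<psi>)) differentiable (at (T $ z))"
    by (subst upd_pred_split)
  then show "(\<lambda>A. L (\<phi>, upd_pred T z A, \<psi>) (\<phi>, T, \<psi>)) differentiable (at (T $ z))"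
    by (rule differentiable_compose [where g = "\<lambda>A. (\<phi>, upd_pred T z A, \<psi>)", OF *])
  show "is_arg_min (\<lambda>A. L (\<phi>, upd_pred T z A, \<psi>) (\<phi>, T, \<psi>)) (\<lambda>_. True) (T $ z)"
    using assms(2) by (simp add: sg_is_arg_min_pred_def is_arg_min_linorder upd_pred_self)
qed

text \<open>Each block gradient gives the normal equation for directions in that block, and a
  general \<open>X\<close> is the sum of its blocks. \<open>\<Lambda>\<close> will be the identity
  for the first loss and transposition for the second.\<close>

lemma dens_map_normal:
  fixes \<Lambda> :: "real ^ 'b ^ 'a ^ 'z::finite \<Rightarrow> real ^ 'q ^ 'p ^ 'z"
  assumes \<Lambda>: "linear \<Lambda>"
    and grad: "\<And>z. gradient (\<lambda>A. dens_loss \<rho> p \<Xi> (f, \<Lambda> (upd_pred Q z A), g)) (Q $ z) = 0"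
  shows "inner (dens_map \<rho> p f (\<Lambda> X) g) (dens_map \<rho> p f (\<Lambda> Q) g - dens_target \<rho> p \<Xi>) = 0"
proof -
  define F where "F = (\<lambda>Q. dens_map \<rho> p f (\<Lambda> Q) g)"
  have F: "linear F"
    unfolding F_def using linear_compose [OF \<Lambda> dens_map_linear_mid] by (simp add: o_def)
  interpret linear F by (rule F)
  have slice: "inner (F (upd_pred 0 z Y)) (F Q - dens_target \<rho> p \<Xi>) = 0" for z Y
  proof -
    have split: "F (upd_pred Q z A) = F (upd_pred 0 z A) + F (upd_pred Q z 0)" for A
      by (metis add upd_pred_split)
    \<comment> \<open>The blocks other than \<open>z\<close> contribute a constant, which is
      absorbed into the target.\<close>
    have "inner Y (gradient (\<lambda>A. dens_loss \<rho> p \<Xi> (f, \<Lambda> (upd_pred Q z A), g)) (Q $ z)) =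
      inner (F (upd_pred 0 z Y))
        (F (upd_pred 0 z (Q $ z)) - (dens_target \<rho> p \<Xi> - F (upd_pred Q z 0)))"
    proof (rule inner_gradient_least_squares)
      show "linear (\<lambda>A. F (upd_pred 0 z A))"
        using linear_compose [OF linear_upd_pred F] by (simp add: o_def)
      show "dens_loss \<rho> p \<Xi> (f, \<Lambda> (upd_pred Q z A), g) =
        1/2 * (norm (F (upd_pred 0 z A) - (dens_target \<rho> p \<Xi> - F (upd_pred Q z 0))))\<^sup>2" for A
        using split [of A] by (simp add: dens_loss_eq F_def algebra_simps)
    qed
    then show ?thesis
      using grad split [of "Q $ z"] by (simp add: upd_pred_self algebra_simps)
  qed
  have "F X = (\<Sum>z\<in>UNIV. F (upd_pred 0 z (X $ z)))"
    by (metis sum sum_upd_pred)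
  then show ?thesis
    using slice by (simp add: inner_sum_left F_def)
qed

section \<open>Conservation of Gram matrices\<close>

text \<open>The squared norm of \<open>\<phi> s *v x\<close> has derivative twice the inner product
  in \<open>orth\<close>. Over all \<open>x\<close>, these norms determine the Gram matrix.\<close>

lemma norm_mult_vec_constant:
  fixes \<phi> :: "real \<Rightarrow> real ^ 'm ^ 's"
  assumes der: "\<And>s. s \<in> S \<Longrightarrow> (\<phi> has_vector_derivative \<phi>' s) (at s within S)"
    and orth: "\<And>s. s \<in> S \<Longrightarrow> inner (\<phi> s *v x) (\<phi>' s *v x) = 0"
    and S: "convex S" "s \<in> S" "t \<in> S"
  shows "norm (\<phi> s *v x) = norm (\<phi> t *v x)"
proof -
  have "((\<lambda>s. inner (\<phi> s *v x) (\<phi> s *v x)) has_derivative (\<lambda>h. 0)) (at s within S)" if "s \<in> S" for s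
  proof -
    have "linear (\<lambda>A :: real ^ 'm ^ 's. A *v x)"
      by (rule linearI) (simp_all add: matrix_vector_mult_add_rdistrib scaleR_matrix_vector_assoc)
    then have "bounded_linear (\<lambda>A :: real ^ 'm ^ 's. A *v x)"
      by (simp add: linear_conv_bounded_linear)
    then have "((\<lambda>s. \<phi> s *v x) has_vector_derivative \<phi>' s *v x) (at s within S)"
      using der [OF that] by (rule bounded_linear.has_vector_derivative)
    then show ?thesis
      unfolding has_vector_derivative_def
      by (rule derivative_eq_intros refl | assumption)+ (use orth [OF that] in \<open>simp add: inner_commute\<close>)
  qed
  then obtain c where "\<forall>s\<in>S. inner (\<phi> s *v x) (\<phi> s *v x) = c"
    using has_derivative_zero_constant [OF S(1), of "\<lambda>s. inner (\<phi> s *v x) (\<phi> s *v x)"] by blast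
  then show ?thesis
    using S by (simp add: norm_eq_sqrt_inner)
qed

section \<open>Decrease of the density loss along the flow\<close>

theorem theorem5:
  fixes \<rho> :: "'s::finite pmf"
    and p :: "'z::finite pmf"
    and \<Xi> :: "'z \<Rightarrow> real ^ 's ^ 's"
    and L\<^sub>\<phi> :: "('s, 'z, 'm::finite, 'n::finite) sg_loss"
    and L\<^sub>\<psi> :: "('s, 'z, 'n, 'm) sg_loss"
    and \<phi> :: "real \<Rightarrow> real ^ 'm ^ 's"
    and \<psi> :: "real \<Rightarrow> real ^ 'n ^ 's"
    and T\<^sub>\<phi> :: "real \<Rightarrow> real ^ 'n ^ 'm ^ 'z"
    and T\<^sub>\<psi> :: "real \<Rightarrow> real ^ 'm ^ 'n ^ 'z"
    and T :: "real \<Rightarrow> real ^ 'n ^ 'm ^ 'z"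
  assumes rho_pos: "\<And>s. pmf \<rho> s > 0"
    and diff_phi: "sg_differentiable L\<^sub>\<phi>"
    and diff_psi: "sg_differentiable L\<^sub>\<psi>"
    and cond1: "\<And>(f :: real ^ 'm ^ 's) (g :: real ^ 'n ^ 's) (P :: real ^ 'n ^ 'm ^ 'z) z.
      gradient (\<lambda>A. dens_loss \<rho> p \<Xi> (f, upd_pred P z A, g)) (P $ z) = sg_grad_pred L\<^sub>\<phi> f P g z"
    and cond2: "\<And>(f :: real ^ 'm ^ 's) (g :: real ^ 'n ^ 's) (Q :: real ^ 'm ^ 'n ^ 'z) z.
      gradient (\<lambda>A. dens_loss \<rho> p \<Xi> (f, transpose_pred (upd_pred Q z A), g)) (Q $ z)
        = sg_grad_pred L\<^sub>\<psi> g Q f z"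
    and cond3: "\<And>(f :: real ^ 'm ^ 's) (g :: real ^ 'n ^ 's) (P :: real ^ 'n ^ 'm ^ 'z).
      gradient (\<lambda>f'. dens_loss \<rho> p \<Xi> (f', P, g)) f = sg_grad_rep L\<^sub>\<phi> f P g"
    and cond4: "\<And>(f :: real ^ 'm ^ 's) (g :: real ^ 'n ^ 's) (Q :: real ^ 'm ^ 'n ^ 'z).
      gradient (\<lambda>g'. dens_loss \<rho> p \<Xi> (f, transpose_pred Q, g')) g = sg_grad_rep L\<^sub>\<psi> g Q f"
    and sol: "ode_solution L\<^sub>\<phi> L\<^sub>\<psi> \<phi> \<psi> T\<^sub>\<phi> T\<^sub>\<psi>"
    and T_min: "\<And>t. t \<ge> 0 \<Longrightarrow>
      is_arg_min (\<lambda>P. dens_loss \<rho> p \<Xi> (\<phi> t, P, \<psi> t)) (\<lambda>_. True) (T t)"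
  shows "\<forall>t\<ge>0. \<exists>D.
    ((\<lambda>t. dens_loss \<rho> p \<Xi> (\<phi> t, T t, \<psi> t)) has_real_derivative D) (at t within {0..}) \<and>
    D \<le> 0 \<and>
    (vector_derivative \<phi> (at t within {0..}) \<noteq> 0 \<or> vector_derivative \<psi> (at t within {0..}) \<noteq> 0
      \<longrightarrow> D < 0)"
proof (intro allI impI)
  fix t :: real
  assume "t \<ge> 0"
  define S where "S = {0::real..}"
  define F :: "real ^ 'm ^ 's \<Rightarrow> real ^ 'n ^ 'm ^ 'z \<Rightarrow> real ^ 'n ^ 's \<Rightarrow> real ^ 's ^ 's ^ 'z"
    where "F = dens_map \<rho> p"
  define c where "c = dens_target \<rho> p \<Xi>"
  define U where "U = (\<lambda>s. transpose_pred (T\<^sub>\<psi> s))"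
  define \<phi>' where "\<phi>' = (\<lambda>s. - sg_grad_rep L\<^sub>\<phi> (\<phi> s) (T\<^sub>\<phi> s) (\<psi> s))"
  define \<psi>' where "\<psi>' = (\<lambda>s. - sg_grad_rep L\<^sub>\<psi> (\<psi> s) (T\<^sub>\<psi> s) (\<phi> s))"
  have t: "t \<in> S" and S: "convex S"
    using \<open>t \<ge> 0\<close> by (auto simp: S_def)
  have lin1: "linear (\<lambda>\<phi>. F \<phi> T \<psi>)" and lin2: "linear (\<lambda>T. F \<phi> T \<psi>)" and lin3: "linear (\<lambda>\<psi>. F \<phi> T \<psi>)"
    for \<phi> T \<psi>
    unfolding F_def by (rule dens_map_linear_left dens_map_linear_mid dens_map_linear_right)+
  have dens: "dens_loss \<rho> p \<Xi> (f, P, g) = 1/2 * (norm (F f P g - c))\<^sup>2" for f P g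
    by (simp add: dens_loss_eq F_def c_def)
  have grad1: "inner v (gradient (\<lambda>f. dens_loss \<rho> p \<Xi> (f, P, g)) f) = inner (F v P g) (F f P g - c)"
    and grad2: "inner X (gradient (\<lambda>P. dens_loss \<rho> p \<Xi> (f, P, g)) P) = inner (F f X g) (F f P g - c)"
    and grad3: "inner w (gradient (\<lambda>g. dens_loss \<rho> p \<Xi> (f, P, g)) g) = inner (F f P w) (F f P g - c)"
    for f P g v X w
    by (rule inner_gradient_least_squares [OF lin1 dens] inner_gradient_least_squares [OF lin2 dens]
        inner_gradient_least_squares [OF lin3 dens])+
  have argmin_\<phi>: "sg_is_arg_min_pred L\<^sub>\<phi> (\<phi> s) (\<psi> s) (T\<^sub>\<phi> s)"
    and argmin_\<psi>: "sg_is_arg_min_pred L\<^sub>\<psi> (\<psi> s) (\<phi> s) (T\<^sub>\<psi> s)"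
    and \<phi>': "(\<phi> has_vector_derivative \<phi>' s) (at s within S)"
    and \<psi>': "(\<psi> has_vector_derivative \<psi>' s) (at s within S)" if "s \<in> S" for s
    using sol that by (auto simp: ode_solution_def S_def \<phi>'_def \<psi>'_def)
  have normal_\<phi>: "inner (F (\<phi> s) X (\<psi> s)) (F (\<phi> s) (T\<^sub>\<phi> s) (\<psi> s) - c) = 0" if "s \<in> S" for s X
    unfolding F_def c_def
    by (rule dens_map_normal [OF linear_ident])
      (simp add: cond1 sg_grad_pred_arg_min [OF diff_phi argmin_\<phi> [OF that]])
  have normal_\<psi>: "inner (F (\<phi> s) X (\<psi> s)) (F (\<phi> s) (U s) (\<psi> s) - c) = 0" if "s \<in> S" for s X
    using dens_map_normal [OF linear_transpose_pred, of \<rho> p \<Xi> "\<phi> s" "T\<^sub>\<psi> s" "\<psi> s" "transpose_pred X"]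
    by (simp add: cond2 sg_grad_pred_arg_min [OF diff_psi argmin_\<psi> [OF that]]
        transpose_pred_invol F_def c_def U_def)
  have normal: "inner (F (\<phi> s) X (\<psi> s)) (F (\<phi> s) (T s) (\<psi> s) - c) = 0" if "s \<in> S" for s X
  proof -
    have "gradient (\<lambda>P. dens_loss \<rho> p \<Xi> (\<phi> s, P, \<psi> s)) (T s) = 0"
    proof (rule gradient_eq_0_at_min)
      show "is_arg_min (\<lambda>P. dens_loss \<rho> p \<Xi> (\<phi> s, P, \<psi> s)) (\<lambda>_. True) (T s)"
        using T_min that by (simp add: S_def)
      show "(\<lambda>P. dens_loss \<rho> p \<Xi> (\<phi> s, P, \<psi> s)) differentiable at (T s)"
        unfolding dens differentiable_def using has_derivative_least_squares [OF lin2] by blast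
    qed
    then show ?thesis
      using grad2 [where P = "T s"] by (metis inner_zero_right)
  qed
  \<comment> \<open>The normal equations determine the fitted value, though not the predictor: the
    difference of two fits lies in the range and is orthogonal to it.\<close>
  have unique: "F (\<phi> s) P (\<psi> s) = F (\<phi> s) (T s) (\<psi> s)"
    if s: "s \<in> S" and P: "\<And>X. inner (F (\<phi> s) X (\<psi> s)) (F (\<phi> s) P (\<psi> s) - c) = 0" for s P
  proof -
    define r where "r = F (\<phi> s) P (\<psi> s) - F (\<phi> s) (T s) (\<psi> s)"
    have r: "F (\<phi> s) (P - T s) (\<psi> s) = r"
      by (simp add: linear_diff [OF lin2] r_def)
    have "inner r r = inner r (F (\<phi> s) P (\<psi> s) - c) - inner r (F (\<phi> s) (T s) (\<psi> s) - c)"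
      by (simp add: r_def inner_diff_right)
    also have "\<dots> = 0"
      using P [of "P - T s"] normal [OF s, of "P - T s"] unfolding r by simp
    finally show ?thesis by (simp add: r_def)
  qed
  \<comment> \<open>Equal fits allow the residual of \<open>T s\<close> here; the predictor applied
    to the direction \<open>h\<close> is still \<open>T\<^sub>\<phi> s\<close>.\<close>
  have flow_\<phi>: "inner h (\<phi>' s) = - inner (F h (T\<^sub>\<phi> s) (\<psi> s)) (F (\<phi> s) (T s) (\<psi> s) - c)"
    if "s \<in> S" for s h
    unfolding \<phi>'_def cond3 [symmetric]
    using unique [OF that normal_\<phi> [OF that]] by (simp add: grad1)
  have flow_\<psi>: "inner h (\<psi>' s) = - inner (F (\<phi> s) (U s) h) (F (\<phi> s) (T s) (\<psi> s) - c)"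
    if "s \<in> S" for s h
    unfolding \<psi>'_def cond4 [symmetric] U_def
    using unique [OF that normal_\<psi> [OF that]] by (simp add: grad3 U_def)
  have gram_\<phi>: "norm (\<phi> s *v x) = norm (\<phi> u *v x)" if "s \<in> S" "u \<in> S" for s u x
  proof (rule norm_mult_vec_constant [OF \<phi>' _ S that])
    show "inner (\<phi> s *v x) (\<phi>' s *v x) = 0" if "s \<in> S" for s
      \<comment> \<open>In this direction the pairing with \<open>\<phi>' s\<close> is the desired
        inner product, while the effect on \<open>F\<close> is that of a predictor change, hence
        orthogonal to the residual.\<close>
      using flow_\<phi> [OF that, of "outer (\<phi> s *v x) x"] normal [OF that]
      by (simp add: inner_outer F_def dens_map_outer_left)
  qed
  have gram_\<psi>: "norm (\<psi> s *v x) = norm (\<psi> u *v x)" if "s \<in> S" "u \<in> S" for s u x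
  proof (rule norm_mult_vec_constant [OF \<psi>' _ S that])
    show "inner (\<psi> s *v x) (\<psi>' s *v x) = 0" if "s \<in> S" for s
      using flow_\<psi> [OF that, of "outer (\<psi> s *v x) x"] normal [OF that]
      by (simp add: inner_outer F_def dens_map_outer_right)
  qed
  obtain C where C: "\<And>(\<phi> :: real ^ 'm ^ 's) \<phi>' T (\<psi> :: real ^ 'n ^ 's) \<psi>'.
    (\<And>v. norm (\<phi> *v v) = norm (\<phi>' *v v)) \<Longrightarrow> (\<And>v. norm (\<psi> *v v) = norm (\<psi>' *v v)) \<Longrightarrow>
    norm (F \<phi> T \<psi>) \<le> C * norm (F \<phi>' T \<psi>')"
    unfolding F_def using norm_dens_map_le [OF rho_pos] by metis
  \<comment> \<open>Makes derivatives within \<open>S\<close> unique, also the one-sided derivative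
    at time 0.\<close>
  have not_bot: "at t within S \<noteq> bot"
    unfolding trivial_limit_within not_not islimpt_approachable
  proof (intro allI impI)
    show "\<exists>s\<in>S. s \<noteq> t \<and> dist s t < e" if "e > 0" for e
      using t that by (intro bexI [of _ "t + e / 2"]) (auto simp: S_def dist_real_def)
  qed
  \<comment> \<open>With only \<open>\<phi>\<close> moving, conservation of its Gram matrix keeps
    \<open>F (\<phi> s) N (\<psi> t)\<close> at zero, so its derivative vanishes.\<close>
  have kernel_\<phi>: "F (\<phi>' t) N (\<psi> t) = 0" if N: "F (\<phi> t) N (\<psi> t) = 0" for N
  proof (rule vector_derivative_unique_within [OF not_bot])
    show "((\<lambda>s. F (\<phi> s) N (\<psi> t)) has_vector_derivative F (\<phi>' t) N (\<psi> t)) (at t within S)"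
      by (rule bounded_linear.has_vector_derivative
          [OF lin1 [unfolded linear_conv_bounded_linear] \<phi>' [OF t]])
    have "F (\<phi> s) N (\<psi> t) = 0" if "s \<in> S" for s
      using C [OF gram_\<phi> [OF that t] refl, of N "\<psi> t"] N by simp
    then show "((\<lambda>s. F (\<phi> s) N (\<psi> t)) has_vector_derivative 0) (at t within S)"
      by (intro has_vector_derivative_transform [OF t _ has_vector_derivative_const [of 0]]) simp
  qed
  have kernel_\<psi>: "F (\<phi> t) N (\<psi>' t) = 0" if N: "F (\<phi> t) N (\<psi> t) = 0" for N
  proof (rule vector_derivative_unique_within [OF not_bot])
    show "((\<lambda>s. F (\<phi> t) N (\<psi> s)) has_vector_derivative F (\<phi> t) N (\<psi>' t)) (at t within S)"
      by (rule bounded_linear.has_vector_derivative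
          [OF lin3 [unfolded linear_conv_bounded_linear] \<psi>' [OF t]])
    have "F (\<phi> t) N (\<psi> s) = 0" if "s \<in> S" for s
      using C [OF refl gram_\<psi> [OF that t], of "\<phi> t" N] N by simp
    then show "((\<lambda>s. F (\<phi> t) N (\<psi> s)) has_vector_derivative 0) (at t within S)"
      by (intro has_vector_derivative_transform [OF t _ has_vector_derivative_const [of 0]]) simp
  qed
  define r where "r = F (\<phi> t) (T t) (\<psi> t) - c"
  define D where "D = inner (F (\<phi> t) (T t) (\<psi>' t) + F (\<phi>' t) (T t) (\<psi> t)) r"
  have deriv: "((\<lambda>s. 1/2 * (norm (F (\<phi> s) (T s) (\<psi> s) - c))\<^sup>2) has_real_derivative D) (at t within S)"
    unfolding D_def r_def
  proof (rule min_least_squares_has_real_derivative [OF lin2 t])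
    show "((\<lambda>s. F (\<phi> s) X (\<psi> s)) has_vector_derivative F (\<phi> t) X (\<psi>' t) + F (\<phi>' t) X (\<psi> t))
        (at t within S)" for X
      unfolding F_def
      by (rule bounded_bilinear.has_vector_derivative [OF bounded_bilinear_dens_map \<phi>' [OF t] \<psi>' [OF t]])
    show le: "norm (F (\<phi> t) X (\<psi> t)) \<le> C * norm (F (\<phi> s) X (\<psi> s))" if "s \<in> S" for s X
      by (rule C) (use gram_\<phi> gram_\<psi> t that in blast)+
    show "F (\<phi> s) X (\<psi> s) = 0" if "s \<in> S" "F (\<phi> t) X (\<psi> t) = 0" for s X
    proof -
      have "norm (F (\<phi> s) X (\<psi> s)) \<le> C * norm (F (\<phi> t) X (\<psi> t))"
        by (rule C) (use gram_\<phi> gram_\<psi> t that in blast)+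
      then show ?thesis using that by simp
    qed
  qed (rule normal)
  \<comment> \<open>Both predictors give the same fit, so their difference is in the kernel and
    \<open>T t\<close> may replace \<open>T\<^sub>\<phi> t\<close> in the flow relation, which is
    then tested with \<open>\<phi>' t\<close> itself.\<close>
  have "F (\<phi>' t) (T t - T\<^sub>\<phi> t) (\<psi> t) = 0"
    by (rule kernel_\<phi>) (simp add: linear_diff [OF lin2] unique [OF t normal_\<phi> [OF t]])
  then have "inner (\<phi>' t) (\<phi>' t) = - inner (F (\<phi>' t) (T t) (\<psi> t)) r"
    using flow_\<phi> [OF t] by (simp add: linear_diff [OF lin2] r_def)
  moreover have "F (\<phi> t) (T t - U t) (\<psi>' t) = 0"
    by (rule kernel_\<psi>) (simp add: linear_diff [OF lin2] unique [OF t normal_\<psi> [OF t]])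
  then have "inner (\<psi>' t) (\<psi>' t) = - inner (F (\<phi> t) (T t) (\<psi>' t)) r"
    using flow_\<psi> [OF t] by (simp add: linear_diff [OF lin2] r_def)
  ultimately have D: "D = - (inner (\<phi>' t) (\<phi>' t) + inner (\<psi>' t) (\<psi>' t))"
    by (simp add: D_def inner_add_left)
  have vd: "vector_derivative \<phi> (at t within S) = \<phi>' t" "vector_derivative \<psi> (at t within S) = \<psi>' t"
    using \<phi>' [OF t] \<psi>' [OF t] by (simp_all add: vector_derivative_within [OF not_bot])
  have D_le: "D \<le> 0"
    using inner_ge_zero [of "\<phi>' t"] inner_ge_zero [of "\<psi>' t"] unfolding D by linarith
  have D_less: "D < 0" if "\<phi>' t \<noteq> 0 \<or> \<psi>' t \<noteq> 0"
    using that inner_ge_zero [of "\<phi>' t"] inner_ge_zero [of "\<psi>' t"]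
      inner_gt_zero_iff [of "\<phi>' t"] inner_gt_zero_iff [of "\<psi>' t"] unfolding D by linarith
  show "\<exists>D. ((\<lambda>t. dens_loss \<rho> p \<Xi> (\<phi> t, T t, \<psi> t)) has_real_derivative D) (at t within {0..}) \<and>
      D \<le> 0 \<and> (vector_derivative \<phi> (at t within {0..}) \<noteq> 0 \<or> vector_derivative \<psi> (at t within {0..}) \<noteq> 0
        \<longrightarrow> D < 0)"
    unfolding dens S_def [symmetric] vd
    by (intro exI [of _ D] conjI impI deriv D_le D_less)
qed

end
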